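(* Let $E$ be a non-empty finite set and let $\mathcal{N} \subseteq 2^E$ be a collection of subsets of $E$. For $A \in \mathcal{N}$ let $\mathrm{ex}(A) = \{a \in A : A \setminus \{a\} \in \mathcal{N}\}$. The following statements are equivalent: 1. $\mathcal{N}$ is the collection of closed sets of a convex geometry on $E$. 2. As $A$ ranges over $\mathcal{N}$, the intervals $[\mathrm{ex}(A), A]$ partition the Boolean lattice $2^E$; that is, for every $D \subseteq E$ there is a unique $A \in \mathcal{N}$ such that $\mathrm{ex}(A) \subseteq D \subseteq A$. 3. For any collection of real numbers $p_i$ and $q_i$, $i \in E$, such that $p_i + q_i = 1$ for all $i \in E$, we have $$\sum_{A \in \mathcal{N}} \ \prod_{i \in E\setminus A} p_i \prod_{j \in \mathrm{ex}(A)} q_j = 1.$$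
   Context: A convex geometry is a pair $(E, \mathcal{N})$ where $E$ is a (finite) set and $\mathcal{N} \subseteq 2^E$ is a collection of subsets of $E$ (called the closed, or convex, sets) satisfying: (N1) $E \in \mathcal{N}$; (N2) if $A, B \in \mathcal{N}$ then $A \cap B \in \mathcal{N}$; (N3) for every $A \in \mathcal{N}$ with $A \neq E$ there is an $x \in E \setminus A$ such that $A \cup \{x\} \in \mathcal{N}$. The empty set is not required to be closed. For sets $X \subseteq Y \subseteq E$, the interval $[X, Y]$ is $\{D : X \subseteq D \subseteq Y\}$. *)

theory Defs
  imports Complex_Main
begin

text \<open>The empty set is not required to be closed.\<close>

definition convex_geometry :: "'a set \<Rightarrow> 'a set set \<Rightarrow> bool" where
  "convex_geometry E \<N> \<longleftrightarrow>
     finite E \<and> \<N> \<subseteq> Pow E \<and>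
     E \<in> \<N> \<and>
     (\<forall>A\<in>\<N>. \<forall>B\<in>\<N>. A \<inter> B \<in> \<N>) \<and>
     (\<forall>A\<in>\<N>. A \<noteq> E \<longrightarrow> (\<exists>x\<in>E - A. A \<union> {x} \<in> \<N>))"

definition extreme :: "'a set set \<Rightarrow> 'a set \<Rightarrow> 'a set" where
  "extreme \<N> A = {a \<in> A. A - {a} \<in> \<N>}"

end

theory Submission
  imports Defs
begin

text \<open>
  In a convex geometry the interval containing \<open>D\<close> is the one of the closure of \<open>D\<close>. Conversely,
  if the intervals partition \<open>2\<^sup>E\<close>, then no closed \<open>A\<close> lies in the interval of a larger closed set,
  so one can descend from any closed superset of \<open>A\<close> to \<open>A\<close> by removing extreme points one at a
  time; this gives (N3). A local exchange argument shows that extreme points of a closed set remain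
  extreme in smaller closed sets, and this gives (N2).

  Expanding \<open>\<Prod>i\<in>E. p i + q i\<close> over subsets \<open>D\<close> of \<open>E\<close> and grouping the terms by the intervals
  gives the sum in (3). In the other direction, if \<open>q\<close> is the indicator function of \<open>D\<close>, that
  sum counts the intervals containing \<open>D\<close>.
\<close>

definition interval_partition :: "'a set \<Rightarrow> 'a set set \<Rightarrow> bool" where
  "interval_partition E \<N> \<longleftrightarrow>
     (\<forall>D. D \<subseteq> E \<longrightarrow> (\<exists>!A. A \<in> \<N> \<and> extreme \<N> A \<subseteq> D \<and> D \<subseteq> A))"

lemma finite_family:
  assumes "finite E" "\<N> \<subseteq> Pow E"
  shows "finite \<N>"
  using assms by (meson finite_Pow_iff finite_subset)

lemma finite_maximalE:
  fixes S :: "'a::order set"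
  assumes "finite S" "a \<in> S"
  obtains m where "m \<in> S" "\<And>b. b \<in> S \<Longrightarrow> m \<le> b \<Longrightarrow> m = b"
  using finite_has_maximal2[OF assms] by blast

lemma finite_minimalE:
  fixes S :: "'a::order set"
  assumes "finite S" "a \<in> S"
  obtains m where "m \<in> S" "\<And>b. b \<in> S \<Longrightarrow> b \<le> m \<Longrightarrow> m = b"
  using finite_has_minimal2[OF assms] by blast

lemma extreme_subset: "extreme \<N> A \<subseteq> A"
  by (auto simp: extreme_def)

section \<open>Convex geometries partition the power set into intervals\<close>

lemma convex_geometry_Inter:
  assumes "convex_geometry E \<N>" "S \<subseteq> \<N>" "S \<noteq> {}"
  shows "\<Inter>S \<in> \<N>"
proof -
  have "finite S"
    using assms finite_family unfolding convex_geometry_def by (metis finite_subset)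
  then show ?thesis
    using assms(3,2)
    by (induction S rule: finite_ne_induct) (use assms(1) in \<open>auto simp: convex_geometry_def\<close>)
qed

text \<open>Take a maximal closed \<open>K\<close> that contains \<open>C\<close> but not
  \<open>A\<close>. By (N3) some \<open>K \<union> {x}\<close> is closed, and maximality forces it
  to contain \<open>A\<close>. So \<open>A - {x} = A \<inter> K\<close>, which is closed by
  (N2).\<close>

lemma convex_geometry_extreme_outside:
  assumes cg: "convex_geometry E \<N>" and C: "C \<in> \<N>" and A: "A \<in> \<N>" and "C \<subset> A"
  shows "\<exists>x\<in>extreme \<N> A. x \<notin> C"
proof -
  let ?S = "{K \<in> \<N>. C \<subseteq> K \<and> \<not> A \<subseteq> K}"
  have "finite ?S"
    using cg finite_family unfolding convex_geometry_def by fastforce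
  moreover have "C \<in> ?S"
    using C \<open>C \<subset> A\<close> by auto
  ultimately obtain K where K: "K \<in> ?S" and max: "\<And>K'. K' \<in> ?S \<Longrightarrow> K \<subseteq> K' \<Longrightarrow> K = K'"
    by (rule finite_maximalE) (erule that, blast)
  have "K \<noteq> E"
    using K A cg unfolding convex_geometry_def by auto
  then obtain x where x: "x \<in> E - K" "K \<union> {x} \<in> \<N>"
    using cg K unfolding convex_geometry_def by blast
  have "A \<subseteq> K \<union> {x}"
    using max[of "K \<union> {x}"] K x by blast
  then have "x \<in> A" "A - {x} = A \<inter> K"
    using K x by auto
  moreover have "A \<inter> K \<in> \<N>"
    using cg A K unfolding convex_geometry_def by blast
  ultimately have "x \<in> extreme \<N> A"
    by (simp add: extreme_def)
  then show ?thesis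
    using K x by blast
qed

lemma convex_geometry_imp_interval_partition:
  assumes cg: "convex_geometry E \<N>"
  shows "interval_partition E \<N>"
  unfolding interval_partition_def
proof (intro allI impI)
  fix D assume D: "D \<subseteq> E"
  define C where "C = \<Inter>{K \<in> \<N>. D \<subseteq> K}"
  have "E \<in> \<N>"
    using cg by (simp add: convex_geometry_def)
  then have C: "C \<in> \<N>"
    unfolding C_def using D by (intro convex_geometry_Inter[OF cg]) auto
  have least: "C \<subseteq> K" if "K \<in> \<N>" "D \<subseteq> K" for K
    using that by (auto simp: C_def)
  have DC: "D \<subseteq> C"
    by (auto simp: C_def)
  show "\<exists>!A. A \<in> \<N> \<and> extreme \<N> A \<subseteq> D \<and> D \<subseteq> A"
  proof (rule ex1I)
    have "extreme \<N> C \<subseteq> D"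
    proof
      fix a assume a: "a \<in> extreme \<N> C"
      show "a \<in> D"
      proof (rule ccontr)
        assume "a \<notin> D"
        \<comment> \<open>Removing an extreme point outside \<open>D\<close> would leave a closed
          superset of \<open>D\<close> smaller than the closure \<open>C\<close>.\<close>
        then have "C \<subseteq> C - {a}"
          using a DC by (intro least) (auto simp: extreme_def)
        then show False
          using a by (auto simp: extreme_def)
      qed
    qed
    then show "C \<in> \<N> \<and> extreme \<N> C \<subseteq> D \<and> D \<subseteq> C"
      using C DC by blast
  next
    fix A assume A: "A \<in> \<N> \<and> extreme \<N> A \<subseteq> D \<and> D \<subseteq> A"
    \<comment> \<open>Leastness gives \<open>C \<subseteq> A\<close>. Were this proper,
      \<open>A\<close> would have an extreme point outside \<open>C\<close>, yet its extreme points
      lie in \<open>D \<subseteq> C\<close>.\<close>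
    then show "A = C"
      using convex_geometry_extreme_outside[OF cg C, of A] least[of A] DC by blast
  qed
qed

section \<open>Interval partitions come from convex geometries\<close>

lemma interval_partition_unique:
  assumes "interval_partition E \<N>" "D \<subseteq> E"
    and "A \<in> \<N>" "extreme \<N> A \<subseteq> D" "D \<subseteq> A"
    and "B \<in> \<N>" "extreme \<N> B \<subseteq> D" "D \<subseteq> B"
  shows "A = B"
  using assms unfolding interval_partition_def by metis

text \<open>Otherwise the set \<open>A\<close> would lie in the intervals of both \<open>A\<close>
  and \<open>K\<close>. The point \<open>c\<close> is what each later descent from \<open>K\<close>
  towards \<open>A\<close> removes.\<close>

lemma interval_partition_extreme_outside:
  assumes ip: "interval_partition E \<N>" and sub: "\<N> \<subseteq> Pow E"
    and "A \<in> \<N>" "K \<in> \<N>" "A \<subset> K"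
  shows "\<exists>c\<in>extreme \<N> K. c \<notin> A"
proof -
  have "\<not> extreme \<N> K \<subseteq> A"
    using interval_partition_unique[OF ip, of A A K] extreme_subset[of \<N> A] assms by auto
  then show ?thesis
    by blast
qed

text \<open>The local exchange: if \<open>K - {c, d}\<close> were not closed, it would still contain
  all extreme points of \<open>K - {c}\<close> and of \<open>K - {d}\<close>, hence lie in both of
  their intervals.\<close>

lemma interval_partition_diamond:
  assumes ip: "interval_partition E \<N>" and sub: "\<N> \<subseteq> Pow E" and K: "K \<in> \<N>"
    and c: "c \<in> extreme \<N> K" and d: "d \<in> extreme \<N> K" and "c \<noteq> d"
  shows "c \<in> extreme \<N> (K - {d})"
proof (rule ccontr)
  assume "c \<notin> extreme \<N> (K - {d})"
  then have "K - {d} - {c} \<notin> \<N>"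
    using c \<open>c \<noteq> d\<close> by (auto simp: extreme_def)
  moreover have "K - {d} - {c} = K - {c} - {d}"
    by blast
  ultimately have "c \<notin> extreme \<N> (K - {d})" "d \<notin> extreme \<N> (K - {c})"
    by (auto simp: extreme_def)
  then have "K - {d} = K - {c}"
    using c d K sub extreme_subset[of \<N> "K - {d}"] extreme_subset[of \<N> "K - {c}"]
    by (intro interval_partition_unique[OF ip, of "K - {c, d}"]) (auto simp: extreme_def)
  then show False
    using c d \<open>c \<noteq> d\<close> by (auto simp: extreme_def)
qed

text \<open>Descend from \<open>K\<close> to \<open>C\<close>, removing extreme points outside
  \<open>C\<close> one by one. Each removed point differs from \<open>c\<close>, so \<open>c\<close>
  stays extreme by the exchange property.\<close>

lemma interval_partition_extreme_mono:
  assumes ip: "interval_partition E \<N>" and sub: "\<N> \<subseteq> Pow E" and fin: "finite E"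
    and C: "C \<in> \<N>" and "K \<in> \<N>" "C \<subseteq> K" "c \<in> extreme \<N> K" "c \<in> C"
  shows "c \<in> extreme \<N> C"
  using assms(5-)
proof (induction "card K" arbitrary: K rule: less_induct)
  case less
  show ?case
  proof (cases "C = K")
    case False
    then obtain d where d: "d \<in> extreme \<N> K" "d \<notin> C"
      using interval_partition_extreme_outside[OF ip sub C] less.prems by blast
    have "finite K"
      using less.prems sub fin by (metis PowD finite_subset subsetD)
    then have "card (K - {d}) < card K"
      using d by (intro card_Diff1_less) (auto simp: extreme_def)
    moreover have "c \<in> extreme \<N> (K - {d})"
      using d less.prems by (intro interval_partition_diamond[OF ip sub]) auto
    ultimately show ?thesis
      using less.prems d by (intro less.hyps[of "K - {d}"]) (auto simp: extreme_def)
  qed (use less in simp)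
qed

lemma interval_partition_ground_closed:
  assumes "interval_partition E \<N>" "\<N> \<subseteq> Pow E"
  shows "E \<in> \<N>"
proof -
  \<comment> \<open>Take the interval that contains \<open>E\<close> itself.\<close>
  obtain A where "A \<in> \<N>" "E \<subseteq> A"
    using assms(1) unfolding interval_partition_def by (metis order_refl)
  then show ?thesis
    using assms(2) by (metis PowD subset_antisym subsetD)
qed

text \<open>A minimal closed \<open>K\<close> above both \<open>A\<close> and \<open>C\<close> must
  be \<open>A\<close>. Otherwise \<open>K\<close> has an extreme point outside \<open>A\<close>; by
  minimality it lies in \<open>C\<close>, so it is extreme in \<open>C\<close> and hence in
  \<open>A\<close>, a contradiction.\<close>

lemma interval_partition_subset_closed:
  assumes ip: "interval_partition E \<N>" and sub: "\<N> \<subseteq> Pow E" and fin: "finite E"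
    and C: "C \<in> \<N>" and A: "A \<in> \<N>" and ex: "extreme \<N> C \<subseteq> A"
  shows "C \<subseteq> A"
proof -
  let ?S = "{K \<in> \<N>. A \<subseteq> K \<and> C \<subseteq> K}"
  have "finite ?S"
    using finite_family[OF fin sub] by simp
  moreover have "E \<in> ?S"
    using interval_partition_ground_closed[OF ip sub] A C sub by auto
  ultimately obtain K where K: "K \<in> ?S" and min: "\<And>K'. K' \<in> ?S \<Longrightarrow> K' \<subseteq> K \<Longrightarrow> K = K'"
    by (rule finite_minimalE) (erule that, blast)
  have "K = A"
  proof (rule ccontr)
    assume "K \<noteq> A"
    then obtain c where c: "c \<in> extreme \<N> K" "c \<notin> A"
      using interval_partition_extreme_outside[OF ip sub A] K by blast
    have "c \<in> C"
      using min[of "K - {c}"] c K by (auto simp: extreme_def)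
    then show False
      using interval_partition_extreme_mono[OF ip sub fin C _ _ c(1)] K c ex by blast
  qed
  then show ?thesis
    using K by blast
qed

lemma interval_partition_imp_convex_geometry:
  assumes ip: "interval_partition E \<N>" and sub: "\<N> \<subseteq> Pow E" and fin: "finite E"
  shows "convex_geometry E \<N>"
proof -
  note E = interval_partition_ground_closed[OF ip sub]
  have "A \<inter> B \<in> \<N>" if A: "A \<in> \<N>" and B: "B \<in> \<N>" for A B
  proof -
    \<comment> \<open>For (N2), the top of the interval containing \<open>A \<inter> B\<close> turns
      out to be \<open>A \<inter> B\<close>.\<close>
    obtain C where C: "C \<in> \<N>" "extreme \<N> C \<subseteq> A \<inter> B" "A \<inter> B \<subseteq> C"
      using ip A sub unfolding interval_partition_def by (metis PowD in_mono le_infI1)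
    then have "C \<subseteq> A" "C \<subseteq> B"
      using interval_partition_subset_closed[OF ip sub fin] A B by auto
    then have "A \<inter> B = C"
      using C by blast
    then show ?thesis
      using C by simp
  qed
  moreover have "\<exists>x\<in>E - A. A \<union> {x} \<in> \<N>" if A: "A \<in> \<N>" and "A \<noteq> E" for A
  proof -
    \<comment> \<open>For (N3), a minimal closed set strictly above \<open>A\<close> has an extreme
      point outside \<open>A\<close>; removing it must give \<open>A\<close>.\<close>
    let ?S = "{K \<in> \<N>. A \<subset> K}"
    have "finite ?S"
      using finite_family[OF fin sub] by simp
    moreover have "E \<in> ?S"
      using E that sub by auto
    ultimately obtain K where K: "K \<in> ?S" and min: "\<And>K'. K' \<in> ?S \<Longrightarrow> K' \<subseteq> K \<Longrightarrow> K = K'"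
      by (rule finite_minimalE) (erule that, blast)
    obtain c where c: "c \<in> extreme \<N> K" "c \<notin> A"
      using interval_partition_extreme_outside[OF ip sub A] K by blast
    have "K - {c} = A"
      using min[of "K - {c}"] c K by (auto simp: extreme_def)
    then have "A \<union> {c} = K" "c \<in> E - A"
      using c K sub by (auto simp: extreme_def)
    then show ?thesis
      using K by blast
  qed
  ultimately show ?thesis
    using E sub fin by (auto simp: convex_geometry_def)
qed

section \<open>Interval partitions and the sum identity\<close>

lemma sum_prod_interval:
  fixes p q :: "'a \<Rightarrow> 'b::comm_ring_1"
  assumes fin: "finite E" and "X \<subseteq> A" "A \<subseteq> E" and pq: "\<And>i. i \<in> E \<Longrightarrow> p i + q i = 1"
  shows "(\<Sum>D | X \<subseteq> D \<and> D \<subseteq> A. prod q D * prod p (E - D)) = prod p (E - A) * prod q X"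
proof -
  have finA: "finite A"
    using fin \<open>A \<subseteq> E\<close> by (rule finite_subset[rotated])
  \<comment> \<open>Write \<open>D = X \<union> Y\<close> with \<open>Y \<subseteq> A - X\<close>.
    The factors over \<open>X\<close> and \<open>E - A\<close> are common to all terms; the others
    add up to the expansion of a product of factors \<open>q i + p i = 1\<close>.\<close>
  have "(\<Sum>D | X \<subseteq> D \<and> D \<subseteq> A. prod q D * prod p (E - D)) =
      (\<Sum>Y\<in>Pow (A - X). prod p (E - A) * prod q X * (prod q Y * prod p (A - X - Y)))"
  proof (rule sum.reindex_bij_witness[where i = "\<lambda>Y. X \<union> Y" and j = "\<lambda>D. D - X"])
    fix D assume D: "D \<in> {D. X \<subseteq> D \<and> D \<subseteq> A}"
    have "prod q D = prod q (D - X) * prod q X"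
      using D finA by (intro prod.subset_diff) (auto intro: finite_subset)
    moreover have "prod p (E - D) = prod p (E - D - (E - A)) * prod p (E - A)"
      using D fin by (intro prod.subset_diff) auto
    moreover have "E - D - (E - A) = A - X - (D - X)"
      using D \<open>A \<subseteq> E\<close> by blast
    ultimately show "prod p (E - A) * prod q X * (prod q (D - X) * prod p (A - X - (D - X))) =
        prod q D * prod p (E - D)"
      by (simp add: mult_ac)
  qed (use \<open>X \<subseteq> A\<close> in auto)
  also have "\<dots> = prod p (E - A) * prod q X * (\<Prod>i\<in>A - X. q i + p i)"
    using finA by (simp add: prod_add sum_distrib_left)
  also have "(\<Prod>i\<in>A - X. q i + p i) = 1"
    using pq \<open>A \<subseteq> E\<close> by (intro prod.neutral) (auto simp: add.commute)
  finally show ?thesis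
    by simp
qed

lemma interval_partition_imp_sum_eq_1:
  fixes p q :: "'a \<Rightarrow> 'b::comm_ring_1"
  assumes ip: "interval_partition E \<N>" and sub: "\<N> \<subseteq> Pow E" and fin: "finite E"
    and pq: "\<And>i. i \<in> E \<Longrightarrow> p i + q i = 1"
  shows "(\<Sum>A\<in>\<N>. prod p (E - A) * prod q (extreme \<N> A)) = 1"
proof -
  let ?I = "\<lambda>A. {D. extreme \<N> A \<subseteq> D \<and> D \<subseteq> A}"
  have finN: "finite \<N>"
    using fin sub by (rule finite_family)
  have sub_Pow: "?I A \<subseteq> Pow E" if "A \<in> \<N>" for A
    using that sub by auto
  have "(\<Sum>A\<in>\<N>. prod p (E - A) * prod q (extreme \<N> A)) =
      (\<Sum>A\<in>\<N>. \<Sum>D\<in>?I A. prod q D * prod p (E - D))"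
    using sub fin pq by (intro sum.cong refl sum_prod_interval[symmetric]) (auto simp: extreme_def)
  \<comment> \<open>Uniqueness makes the intervals disjoint, which merges the double sum; existence
    then makes their union all of \<open>Pow E\<close>.\<close>
  also have "\<dots> = (\<Sum>D\<in>(\<Union>A\<in>\<N>. ?I A). prod q D * prod p (E - D))"
  proof (rule sum.UNION_disjoint[symmetric])
    show "\<forall>A\<in>\<N>. finite (?I A)"
      using fin sub_Pow by (meson finite_Pow_iff finite_subset)
    show "\<forall>A\<in>\<N>. \<forall>B\<in>\<N>. A \<noteq> B \<longrightarrow> ?I A \<inter> ?I B = {}"
    proof (intro ballI impI equals0I)
      fix A B D
      assume "A \<in> \<N>" "B \<in> \<N>" "A \<noteq> B" and "D \<in> ?I A \<inter> ?I B"
      moreover from this have "D \<subseteq> E"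
        using sub_Pow[of A] by blast
      ultimately show False
        using interval_partition_unique[OF ip, of D A B] by simp
    qed
  qed (fact finN)
  also have "(\<Union>A\<in>\<N>. ?I A) = Pow E"
  proof
    show "(\<Union>A\<in>\<N>. ?I A) \<subseteq> Pow E"
      using sub_Pow by (rule UN_least)
    show "Pow E \<subseteq> (\<Union>A\<in>\<N>. ?I A)"
    proof
      fix D assume "D \<in> Pow E"
      then obtain A where "A \<in> \<N>" "extreme \<N> A \<subseteq> D" "D \<subseteq> A"
        using ip unfolding interval_partition_def by (metis PowD)
      then show "D \<in> (\<Union>A\<in>\<N>. ?I A)"
        by auto
    qed
  qed
  also have "(\<Sum>D\<in>Pow E. prod q D * prod p (E - D)) = (\<Prod>i\<in>E. q i + p i)"
    using fin by (simp add: prod_add)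
  also have "\<dots> = 1"
    using pq by (intro prod.neutral) (auto simp: add.commute)
  finally show ?thesis .
qed

lemma prod_of_bool:
  assumes "finite S"
  shows "(\<Prod>i\<in>S. of_bool (P i)) = (of_bool (\<forall>i\<in>S. P i) :: 'b::comm_semiring_1)"
  using assms by (induction S) auto

lemma sum_eq_1_imp_interval_partition:
  assumes sub: "\<N> \<subseteq> Pow E" and fin: "finite E"
    and sum1: "\<And>p q :: 'a \<Rightarrow> 'b::{comm_ring_1, ring_char_0}. (\<And>i. i \<in> E \<Longrightarrow> p i + q i = 1) \<Longrightarrow>
      (\<Sum>A\<in>\<N>. prod p (E - A) * prod q (extreme \<N> A)) = 1"
  shows "interval_partition E \<N>"
  unfolding interval_partition_def
proof (intro allI impI)
  fix D assume D: "D \<subseteq> E"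
  let ?P = "\<lambda>A. extreme \<N> A \<subseteq> D \<and> D \<subseteq> A"
  \<comment> \<open>With these 0/1 values the term of \<open>A\<close> is 1 if \<open>D\<close> lies
    in the interval of \<open>A\<close>, and 0 otherwise.\<close>
  let ?p = "\<lambda>i. of_bool (i \<notin> D) :: 'b" and ?q = "\<lambda>i. of_bool (i \<in> D) :: 'b"
  have finN: "finite \<N>"
    using fin sub by (rule finite_family)
  have "prod ?p (E - A) * prod ?q (extreme \<N> A) = of_bool (?P A)" if "A \<in> \<N>" for A
  proof -
    have "finite (extreme \<N> A)"
      using that sub fin extreme_subset[of \<N> A] by (meson PowD finite_subset subsetD)
    then have "prod ?p (E - A) * prod ?q (extreme \<N> A) =
        of_bool (\<forall>i\<in>E - A. i \<notin> D) * of_bool (\<forall>i\<in>extreme \<N> A. i \<in> D)"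
      using fin by (simp only: prod_of_bool finite_Diff)
    also have "\<dots> = of_bool (?P A)"
      using D by (auto simp: of_bool_def)
    finally show ?thesis .
  qed
  then have "(\<Sum>A\<in>\<N>. of_bool (?P A)) = (1 :: 'b)"
    using sum1[of ?p ?q] by simp
  then have "of_nat (card (\<N> \<inter> Collect ?P)) = (1 :: 'b)"
    using finN by (simp)
  \<comment> \<open>Characteristic 0 turns the equation in the ring into an exact count.\<close>
  then have "card (\<N> \<inter> Collect ?P) = 1"
    by (metis of_nat_1 of_nat_eq_iff)
  then obtain A where "\<N> \<inter> Collect ?P = {A}"
    by (rule card_1_singletonE)
  then show "\<exists>!A. A \<in> \<N> \<and> extreme \<N> A \<subseteq> D \<and> D \<subseteq> A"
    by (auto simp: set_eq_iff)
qed

theorem theorem3p1: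
  fixes E :: "'a set" and \<N> :: "'a set set"
  assumes "finite E" and "E \<noteq> {}" and "\<N> \<subseteq> Pow E"
  shows "(convex_geometry E \<N> \<longleftrightarrow>
            (\<forall>D. D \<subseteq> E \<longrightarrow> (\<exists>!A. A \<in> \<N> \<and> extreme \<N> A \<subseteq> D \<and> D \<subseteq> A))) \<and>
         (convex_geometry E \<N> \<longleftrightarrow>
            (\<forall>p q :: 'a \<Rightarrow> real. (\<forall>i\<in>E. p i + q i = 1) \<longrightarrow>
               (\<Sum>A\<in>\<N>. (\<Prod>i\<in>E - A. p i) * (\<Prod>j\<in>extreme \<N> A. q j)) = 1))"
proof -
  \<comment> \<open>The interval partition is the hub: each of the other two statements is shown
    equivalent to it.\<close>
  have "convex_geometry E \<N> \<longleftrightarrow> interval_partition E \<N>"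
    using convex_geometry_imp_interval_partition interval_partition_imp_convex_geometry assms
    by blast
  moreover have "interval_partition E \<N> \<longleftrightarrow>
      (\<forall>p q :: 'a \<Rightarrow> real. (\<forall>i\<in>E. p i + q i = 1) \<longrightarrow>
         (\<Sum>A\<in>\<N>. prod p (E - A) * prod q (extreme \<N> A)) = 1)"
  proof (intro iffI allI impI)
    fix p q :: "'a \<Rightarrow> real"
    assume "interval_partition E \<N>" "\<forall>i\<in>E. p i + q i = 1"
    then show "(\<Sum>A\<in>\<N>. prod p (E - A) * prod q (extreme \<N> A)) = 1"
      using assms by (intro interval_partition_imp_sum_eq_1) auto
  next
    assume "\<forall>p q :: 'a \<Rightarrow> real. (\<forall>i\<in>E. p i + q i = 1) \<longrightarrow>
      (\<Sum>A\<in>\<N>. prod p (E - A) * prod q (extreme \<N> A)) = 1"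
    then show "interval_partition E \<N>"
      using assms by (intro sum_eq_1_imp_interval_partition[where 'b = real]) auto
  qed
  ultimately show ?thesis
    unfolding interval_partition_def by simp
qed

end
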